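(* Let $u$, $u_n$, $n=1,2,\ldots$, be fuzzy sets in $F^1_{USC}(X)$. (i) The following are equivalent: (i-1) $\lim_{n\to\infty}H^*({\rm end}\,u,{\rm end}\,u_n)=0$; (i-2) for each $\alpha\in[0,1)$ and $\xi\in(0,1-\alpha]$, $\lim_{n\to\infty}H^*([u]_{\alpha+\xi},[u_n]_\alpha)=0$; (i-3) there is a dense subset $P$ of $[0,1)$ such that for each $\alpha\in P$ and $\xi\in(0,1-\alpha]$, $\lim_{n\to\infty}H^*([u]_{\alpha+\xi},[u_n]_\alpha)=0$. (ii) The following are equivalent: (ii-1) $\lim_{n\to\infty}H^*({\rm end}\,u_n,{\rm end}\,u)=0$; (ii-2) for each $\alpha\in(0,1]$ and $\zeta\in(0,\alpha]$, $\lim_{n\to\infty}H^*([u_n]_\alpha,[u]_{\alpha-\zeta})=0$; (ii-3) there is a dense subset $P$ of $(0,1]$ such that for each $\alpha\in P$ and $\zeta\in(0,\alpha]$, $\lim_{n\to\infty}H^*([u_n]_\alpha,[u]_{\alpha-\zeta})=0$.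
   Context: $(X,d)$ is a nonempty metric space. $X\times[0,1]$ carries the metric $\overline d((x,\alpha),(y,\beta))=d(x,y)+|\alpha-\beta|$. A fuzzy set in $X$ is a function $u:X\to[0,1]$, with $\alpha$-cuts $[u]_\alpha=\{x\in X: u(x)\ge\alpha\}$ for $\alpha\in(0,1]$ and $[u]_0=\overline{\{x\in X:u(x)>0\}}$ (closure in $X$). $F^1_{USC}(X)$ is the set of fuzzy sets $u$ in $X$ such that $[u]_\alpha$ is nonempty and closed for all $\alpha\in[0,1]$. For nonempty closed sets $A,B$, $H^*(A,B)=\sup_{a\in A}\inf_{b\in B}\rho(a,b)\in[0,+\infty]$, with $\rho=d$ for subsets of $X$ and $\rho=\overline d$ for subsets of $X\times[0,1]$. ${\rm end}\,u=\{(x,t)\in X\times[0,1]:u(x)\ge t\}$. *)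

theory Defs
  imports "HOL-Analysis.Analysis"
begin

text \<open>The metric space $X$ is the universe of a type of class \<open>metric_space\<close>. Fuzzy sets are
  real-valued functions; the restriction of the values to $[0,1]$ is part of
  \<open>fuzzy_set\<close>.\<close>

definition fuzzy_set :: "('a \<Rightarrow> real) \<Rightarrow> bool" where
  "fuzzy_set u \<longleftrightarrow> (\<forall>x. 0 \<le> u x \<and> u x \<le> 1)"

text \<open>Meaningful for $\alpha \in [0,1]$ only.\<close>

definition alpha_cut :: "('a::metric_space \<Rightarrow> real) \<Rightarrow> real \<Rightarrow> 'a set" where
  "alpha_cut u \<alpha> = (if \<alpha> = 0 then closure {x. u x > 0} else {x. u x \<ge> \<alpha>})"

definition F1_USC :: "('a::metric_space \<Rightarrow> real) set" where
  "F1_USC = {u. fuzzy_set u \<and> (\<forall>\<alpha>\<in>{0..1}. alpha_cut u \<alpha> \<noteq> {} \<and> closed (alpha_cut u \<alpha>))}"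

definition endograph :: "('a \<Rightarrow> real) \<Rightarrow> ('a \<times> real) set" where
  "endograph u = {(x, t). t \<in> {0..1} \<and> u x \<ge> t}"

text \<open>The sum metric on $X \times [0,1]$. The library instance of \<open>dist\<close> on products is the
  Euclidean one, so it is not used here.\<close>

definition dist_sum :: "'a::metric_space \<times> real \<Rightarrow> 'a \<times> real \<Rightarrow> real" where
  "dist_sum p q = dist (fst p) (fst q) + \<bar>snd p - snd q\<bar>"

text \<open>The one-sided Hausdorff distance (excess) of \<open>A\<close> over \<open>B\<close> with respect to \<open>\<rho>\<close>;
  the value $+\infty$ is possible.\<close>

definition Hstar :: "('b \<Rightarrow> 'b \<Rightarrow> real) \<Rightarrow> 'b set \<Rightarrow> 'b set \<Rightarrow> ennreal" where
  "Hstar \<rho> A B = (SUP a\<in>A. INF b\<in>B. ennreal (\<rho> a b))"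

definition dense_subset :: "real set \<Rightarrow> real set \<Rightarrow> bool" where
  "dense_subset P S \<longleftrightarrow> P \<subseteq> S \<and> S \<subseteq> closure P"

end

theory Submission
  imports Defs
begin

text \<open>The two parts are one statement about two sequences of fuzzy sets $A_n$, $B_n$: the first
  with $A_n = u$, $B_n = u_n$, the second with $A_n = u_n$, $B_n = u$. The condition on the
  cuts at all levels says in either part that $H^*([A_n]_t, [B_n]_s) \to 0$ whenever
  $0 \le s < t \le 1$; the two parts merely parametrize the pair $s < t$ by a different end point.

  For the endographs, a point $(y, r)$ of ${\rm end}\,v$ closer than $t - s$ to $(x, t)$ has height
  $r > s$, so $y \in [v]_s$: closeness of endographs passes to cuts, at the price of the gap between
  the levels (\<open>excess_alpha_cut_if_excess_endograph\<close>). Conversely, finitely many levels $j/N$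
  suffice: a point $(x, t)$ is approximated by rounding $t$ down to a grid level, moving $x$ into
  the cut of $B_n$ one level lower, and charging the loss of at most $2/N$ in height to the
  second coordinate (\<open>tendsto_Hstar_endograph_iff\<close>).

  The passage from a dense set of levels to all levels rests on cuts decreasing in the level: a dense
  set meets the gap between $s$ and $t$, and $H^*([A]_t, [B]_s)$ only decreases when the gap widens
  (\<open>tendsto_Hstar_alpha_cut_widen\<close>).\<close>

section \<open>The excess of one set over another\<close>

lemma Hstar_mono:
  assumes "A \<subseteq> A'" "B' \<subseteq> B"
  shows "Hstar \<rho> A B \<le> Hstar \<rho> A' B'"
  unfolding Hstar_def using assms by (intro SUP_subset_mono INF_superset_mono) auto

text \<open>If $H^* < e$, every point of the first set has a point of the second at distance less
  than $e$; the converse only yields $H^* \le e$, because the supremum need not be attained. The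
  quantifier over $e$ absorbs this difference.\<close>

lemma tendsto_Hstar_0_iff:
  "((\<lambda>n. Hstar \<rho> (A n) (B n)) \<longlongrightarrow> 0) F \<longleftrightarrow>
     (\<forall>e>0. \<forall>\<^sub>F n in F. \<forall>a\<in>A n. \<exists>b\<in>B n. \<rho> a b < e)"
proof
  assume lim: "((\<lambda>n. Hstar \<rho> (A n) (B n)) \<longlongrightarrow> 0) F"
  show "\<forall>e>0. \<forall>\<^sub>F n in F. \<forall>a\<in>A n. \<exists>b\<in>B n. \<rho> a b < e"
  proof (intro allI impI)
    fix e :: real assume e: "e > 0"
    have "\<forall>\<^sub>F n in F. Hstar \<rho> (A n) (B n) < ennreal e"
      using order_tendstoD(2)[OF lim] e by simp
    then show "\<forall>\<^sub>F n in F. \<forall>a\<in>A n. \<exists>b\<in>B n. \<rho> a b < e"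
    proof eventually_elim
      case (elim n)
      show ?case
      proof
        fix a assume "a \<in> A n"
        then have "(INF b\<in>B n. ennreal (\<rho> a b)) \<le> Hstar \<rho> (A n) (B n)"
          unfolding Hstar_def by (rule SUP_upper)
        also note elim
        finally obtain b where "b \<in> B n" "ennreal (\<rho> a b) < ennreal e"
          unfolding INF_less_iff by blast
        then show "\<exists>b\<in>B n. \<rho> a b < e"
          using e by (metis ennreal_leI leD leI)
      qed
    qed
  qed
next
  assume near: "\<forall>e>0. \<forall>\<^sub>F n in F. \<forall>a\<in>A n. \<exists>b\<in>B n. \<rho> a b < e"
  show "((\<lambda>n. Hstar \<rho> (A n) (B n)) \<longlongrightarrow> 0) F"
  proof (rule order_tendstoI)
    fix c :: ennreal assume "0 < c"
    then obtain e where e: "0 < ennreal e" "ennreal e < c"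
      by (metis dense ennreal_cases top.not_eq_extremum less_top order_less_trans not_less_iff_gr_or_eq)
    from near e(1) have "\<forall>\<^sub>F n in F. \<forall>a\<in>A n. \<exists>b\<in>B n. \<rho> a b < e"
      by simp
    then show "\<forall>\<^sub>F n in F. Hstar \<rho> (A n) (B n) < c"
    proof eventually_elim
      case (elim n)
      have "Hstar \<rho> (A n) (B n) \<le> ennreal e"
        unfolding Hstar_def
      proof (rule SUP_least)
        fix a assume "a \<in> A n"
        with elim obtain b where "b \<in> B n" "\<rho> a b < e" by blast
        then show "(INF b\<in>B n. ennreal (\<rho> a b)) \<le> ennreal e"
          by (intro INF_lower2[of b] ennreal_leI) auto
      qed
      with e(2) show ?case by simp
    qed
  qed simp
qed

section \<open>Endographs and cuts\<close>

text \<open>The cut at level $0$ is a closure of the points of positive membership, and these include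
  every cut at a positive level.\<close>

lemma alpha_cut_antimono:
  assumes "0 \<le> s" "s \<le> t"
  shows "alpha_cut u t \<subseteq> alpha_cut u s"
proof (cases "s = 0 \<and> t > 0")
  case True
  then have "alpha_cut u t \<subseteq> {x. u x > 0}" by (auto simp: alpha_cut_def)
  also have "\<dots> \<subseteq> alpha_cut u s"
    using True by (simp add: alpha_cut_def closure_subset)
  finally show ?thesis .
qed (use assms in \<open>auto simp: alpha_cut_def\<close>)

lemma tendsto_Hstar_alpha_cut_widen:
  assumes lim: "((\<lambda>n. Hstar \<rho> (alpha_cut (A n) t) (alpha_cut (B n) s)) \<longlongrightarrow> 0) F"
    and "0 \<le> s'" "s' \<le> s" "0 \<le> t" "t \<le> t'"
  shows "((\<lambda>n. Hstar \<rho> (alpha_cut (A n) t') (alpha_cut (B n) s')) \<longlongrightarrow> 0) F"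
proof (rule tendsto_sandwich[OF _ _ tendsto_const lim])
  show "\<forall>\<^sub>F n in F. Hstar \<rho> (alpha_cut (A n) t') (alpha_cut (B n) s')
      \<le> Hstar \<rho> (alpha_cut (A n) t) (alpha_cut (B n) s)"
    using assms by (intro always_eventually allI Hstar_mono alpha_cut_antimono)
qed simp

lemma excess_alpha_cut_if_excess_endograph:
  assumes near: "\<forall>p\<in>endograph u. \<exists>q\<in>endograph v. dist_sum p q < e"
    and levels: "0 \<le> s" "s < t" "t \<le> 1" and "e \<le> t - s"
  shows "\<forall>x\<in>alpha_cut u t. \<exists>y\<in>alpha_cut v s. dist x y < e"
proof
  fix x assume "x \<in> alpha_cut u t"
  with levels have "(x, t) \<in> endograph u"
    by (simp add: alpha_cut_def endograph_def)
  with near obtain y r where yr: "(y, r) \<in> endograph v" "dist x y + \<bar>t - r\<bar> < e"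
    unfolding dist_sum_def by fastforce
  have "s < r" using yr(2) \<open>e \<le> t - s\<close> zero_le_dist[of x y] by linarith
  with yr(1) have "y \<in> alpha_cut v r"
    using levels by (simp add: alpha_cut_def endograph_def)
  also have "\<dots> \<subseteq> alpha_cut v s"
    using levels \<open>s < r\<close> by (intro alpha_cut_antimono) auto
  finally show "\<exists>y\<in>alpha_cut v s. dist x y < e"
    using yr(2) by (intro bexI[of _ y]) auto
qed

text \<open>From cuts to endographs only the $N$ pairs of consecutive levels of a grid enter, so
  that finitely many limits can be taken simultaneously. Heights below the first positive level
  are handled by the base line $X \times \{0\}$, which the endograph of a nonnegative
  function contains.\<close>

lemma excess_endograph_if_excess_alpha_cut_grid:
  fixes u v :: "'a::metric_space \<Rightarrow> real" and N :: nat
  assumes v: "\<And>x. 0 \<le> v x" and N: "N > 0"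
    and near: "\<And>j. j < N \<Longrightarrow>
      \<forall>x\<in>alpha_cut u ((real j + 1) / N). \<exists>y\<in>alpha_cut v (real j / N). dist x y < 1 / N"
  shows "\<forall>p\<in>endograph u. \<exists>q\<in>endograph v. dist_sum p q < 3 / N"
proof safe
  fix x t assume xt: "(x, t) \<in> endograph u"
  define k where "k = nat \<lfloor>N * t\<rfloor>"
  have t: "0 \<le> t" "t \<le> 1" "t \<le> u x" using xt by (auto simp: endograph_def)
  have "0 \<le> real N * t" using t by simp
  then have "real k \<le> N * t" "N * t < real k + 1"
    unfolding k_def by linarith+
  then have k: "real k / N \<le> t" "t < (real k + 1) / N"
    using N by (simp_all add: field_simps)
  have "real N * t \<le> real N" using t by (simp add: mult_left_le)
  then have "k \<le> N"
    using \<open>real k \<le> N * t\<close> by linarith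
  show "\<exists>q\<in>endograph v. dist_sum (x, t) q < 3 / N"
  proof (cases k)
    case 0
    have "(x, 0) \<in> endograph v" using v by (simp add: endograph_def)
    moreover have "dist_sum (x, t) (x, 0) < 3 / N"
      using k(2) t N 0 by (simp add: dist_sum_def field_simps)
    ultimately show ?thesis by blast
  next
    case (Suc j)
    then have "j < N" using \<open>k \<le> N\<close> by simp
    have "x \<in> alpha_cut u ((real j + 1) / N)"
      using k(1) t(3) Suc N by (simp add: alpha_cut_def add.commute)
    with near[OF \<open>j < N\<close>] obtain y where y: "y \<in> alpha_cut v (real j / N)" "dist x y < 1 / N"
      by blast
    \<comment> \<open>For \<open>j = 0\<close> the point \<open>y\<close> lies only in a closure, but height \<open>0\<close> is always allowed.\<close>
    have "(y, real j / N) \<in> endograph v"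
      using y(1) v \<open>j < N\<close> by (auto simp: alpha_cut_def endograph_def split: if_splits)
    moreover have "real j / N \<le> t" "t < real j / N + 2 / N"
      using k N Suc by (simp_all add: field_simps)
    then have "dist_sum (x, t) (y, real j / N) < 3 / N"
      using y(2) by (simp add: dist_sum_def)
    ultimately show ?thesis by blast
  qed
qed

theorem tendsto_Hstar_endograph_iff:
  fixes A B :: "'b \<Rightarrow> 'a::metric_space \<Rightarrow> real"
  assumes B: "\<forall>\<^sub>F n in F. \<forall>x. 0 \<le> B n x"
  shows "((\<lambda>n. Hstar dist_sum (endograph (A n)) (endograph (B n))) \<longlongrightarrow> 0) F \<longleftrightarrow>
    (\<forall>s t. 0 \<le> s \<longrightarrow> s < t \<longrightarrow> t \<le> 1 \<longrightarrow>
      ((\<lambda>n. Hstar dist (alpha_cut (A n) t) (alpha_cut (B n) s)) \<longlongrightarrow> 0) F)"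
    (is "?graphs \<longleftrightarrow> ?cuts")
proof
  assume graphs: ?graphs
  show ?cuts
  proof (intro allI impI)
    fix s t :: real assume st: "0 \<le> s" "s < t" "t \<le> 1"
    show "((\<lambda>n. Hstar dist (alpha_cut (A n) t) (alpha_cut (B n) s)) \<longlongrightarrow> 0) F"
      unfolding tendsto_Hstar_0_iff
    proof (intro allI impI)
      fix e :: real assume "e > 0"
      define e' where "e' = min e (t - s)"
      have "e' > 0" "e' \<le> e" "e' \<le> t - s"
        using \<open>e > 0\<close> st by (auto simp: e'_def)
      have "\<forall>\<^sub>F n in F. \<forall>p\<in>endograph (A n). \<exists>q\<in>endograph (B n). dist_sum p q < e'"
        using graphs \<open>e' > 0\<close> unfolding tendsto_Hstar_0_iff by blast
      then show "\<forall>\<^sub>F n in F. \<forall>x\<in>alpha_cut (A n) t. \<exists>y\<in>alpha_cut (B n) s. dist x y < e"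
      proof eventually_elim
        case (elim n)
        from excess_alpha_cut_if_excess_endograph[OF elim st \<open>e' \<le> t - s\<close>]
        show ?case using \<open>e' \<le> e\<close> by (meson less_le_trans)
      qed
    qed
  qed
next
  assume cuts: ?cuts
  show ?graphs
    unfolding tendsto_Hstar_0_iff
  proof (intro allI impI)
    fix e :: real assume e: "e > 0"
    obtain N :: nat where "3 / e < N" using reals_Archimedean2 by blast
    moreover have "0 < 3 / e" using e by simp
    ultimately have "0 < real N" by linarith
    then have N: "N > 0" "3 / N < e"
      using e \<open>3 / e < N\<close> by (simp_all add: field_simps)
    have "\<forall>\<^sub>F n in F. \<forall>x\<in>alpha_cut (A n) ((real j + 1) / N).
        \<exists>y\<in>alpha_cut (B n) (real j / N). dist x y < 1 / N" if "j < N" for j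
    proof -
      have "0 \<le> real j / N" "real j / N < (real j + 1) / N" "(real j + 1) / N \<le> 1"
        using that by (simp_all add: field_simps)
      with cuts have "((\<lambda>n. Hstar dist (alpha_cut (A n) ((real j + 1) / N))
          (alpha_cut (B n) (real j / N))) \<longlongrightarrow> 0) F"
        by blast
      moreover have "0 < 1 / real N" using N by simp
      ultimately show ?thesis unfolding tendsto_Hstar_0_iff by blast
    qed
    then have "\<forall>\<^sub>F n in F. \<forall>j\<in>{..<N}. \<forall>x\<in>alpha_cut (A n) ((real j + 1) / N).
        \<exists>y\<in>alpha_cut (B n) (real j / N). dist x y < 1 / N"
      by (intro eventually_ball_finite) auto
    with B show "\<forall>\<^sub>F n in F. \<forall>p\<in>endograph (A n). \<exists>q\<in>endograph (B n). dist_sum p q < e"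
    proof eventually_elim
      case (elim n)
      have "\<forall>p\<in>endograph (A n). \<exists>q\<in>endograph (B n). dist_sum p q < 3 / N"
        using elim N(1) by (intro excess_endograph_if_excess_alpha_cut_grid) auto
      then show ?case using N(2) by (meson less_trans)
    qed
  qed
qed

section \<open>Dense sets of levels\<close>

lemma dense_subset_between:
  assumes P: "dense_subset P S" and "s < t" "{s<..<t} \<subseteq> S"
  obtains p where "p \<in> P" "s < p" "p < t"
proof -
  have "(s + t) / 2 \<in> {s<..<t}" using \<open>s < t\<close> by simp
  then have "{s<..<t} \<inter> closure P \<noteq> {}"
    using assms unfolding dense_subset_def by blast
  then have "{s<..<t} \<inter> P \<noteq> {}"
    by (simp add: open_Int_closure_eq_empty)
  with that show ?thesis by auto
qed

text \<open>The dense set carries the lower level when the limit function is approximated by the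
  sequence, and the upper level in the reverse situation.
  A level \<open>p\<close> of the dense set strictly between \<open>s\<close> and \<open>t\<close> replaces the level on that
  side; this narrows the gap, and widening it back preserves the limit.\<close>

lemma tendsto_Hstar_alpha_cut_dense_lower:
  assumes P: "dense_subset P {0..<1}"
    and lim: "\<forall>\<alpha>\<in>P. \<forall>\<xi>\<in>{0<..1 - \<alpha>}.
      ((\<lambda>n. Hstar \<rho> (alpha_cut (A n) (\<alpha> + \<xi>)) (alpha_cut (B n) \<alpha>)) \<longlongrightarrow> 0) F"
    and st: "0 \<le> s" "s < t" "t \<le> 1"
  shows "((\<lambda>n. Hstar \<rho> (alpha_cut (A n) t) (alpha_cut (B n) s)) \<longlongrightarrow> 0) F"
proof -
  obtain p where p: "p \<in> P" "s < p" "p < t"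
    using dense_subset_between[OF P \<open>s < t\<close>] st by force
  with lim st have "((\<lambda>n. Hstar \<rho> (alpha_cut (A n) (p + (t - p))) (alpha_cut (B n) p)) \<longlongrightarrow> 0) F"
    by (intro lim[rule_format]) auto
  then show ?thesis
    by (rule tendsto_Hstar_alpha_cut_widen) (use p st in auto)
qed

lemma tendsto_Hstar_alpha_cut_dense_upper:
  assumes P: "dense_subset P {0<..1}"
    and lim: "\<forall>\<alpha>\<in>P. \<forall>\<zeta>\<in>{0<..\<alpha>}.
      ((\<lambda>n. Hstar \<rho> (alpha_cut (A n) \<alpha>) (alpha_cut (B n) (\<alpha> - \<zeta>))) \<longlongrightarrow> 0) F"
    and st: "0 \<le> s" "s < t" "t \<le> 1"
  shows "((\<lambda>n. Hstar \<rho> (alpha_cut (A n) t) (alpha_cut (B n) s)) \<longlongrightarrow> 0) F"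
proof -
  obtain p where p: "p \<in> P" "s < p" "p < t"
    using dense_subset_between[OF P \<open>s < t\<close>] st by force
  with lim st have "((\<lambda>n. Hstar \<rho> (alpha_cut (A n) p) (alpha_cut (B n) (p - (p - s)))) \<longlongrightarrow> 0) F"
    by (intro lim[rule_format]) auto
  then show ?thesis
    by (rule tendsto_Hstar_alpha_cut_widen) (use p st in auto)
qed

lemma dense_subset_refl: "dense_subset S S"
  by (simp add: dense_subset_def closure_subset)

section \<open>Endograph convergence by cuts\<close>

theorem theorem5p7:
  fixes u :: "'a::metric_space \<Rightarrow> real"
    and U :: "nat \<Rightarrow> 'a \<Rightarrow> real"
  assumes "u \<in> F1_USC"
    and "\<And>n. n \<ge> 1 \<Longrightarrow> U n \<in> F1_USC"
  shows
    "(((\<lambda>n. Hstar dist_sum (endograph u) (endograph (U n))) \<longlonglongrightarrow> 0)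
        \<longleftrightarrow> (\<forall>\<alpha>\<in>{0..<1}. \<forall>\<xi>\<in>{0<..1 - \<alpha>}.
              (\<lambda>n. Hstar dist (alpha_cut u (\<alpha> + \<xi>)) (alpha_cut (U n) \<alpha>)) \<longlonglongrightarrow> 0))
     \<and> ((\<forall>\<alpha>\<in>{0..<1}. \<forall>\<xi>\<in>{0<..1 - \<alpha>}.
              (\<lambda>n. Hstar dist (alpha_cut u (\<alpha> + \<xi>)) (alpha_cut (U n) \<alpha>)) \<longlonglongrightarrow> 0)
        \<longleftrightarrow> (\<exists>P. dense_subset P {0..<1} \<and> (\<forall>\<alpha>\<in>P. \<forall>\<xi>\<in>{0<..1 - \<alpha>}.
              (\<lambda>n. Hstar dist (alpha_cut u (\<alpha> + \<xi>)) (alpha_cut (U n) \<alpha>)) \<longlonglongrightarrow> 0)))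
     \<and> (((\<lambda>n. Hstar dist_sum (endograph (U n)) (endograph u)) \<longlonglongrightarrow> 0)
        \<longleftrightarrow> (\<forall>\<alpha>\<in>{0<..1}. \<forall>\<zeta>\<in>{0<..\<alpha>}.
              (\<lambda>n. Hstar dist (alpha_cut (U n) \<alpha>) (alpha_cut u (\<alpha> - \<zeta>))) \<longlonglongrightarrow> 0))
     \<and> ((\<forall>\<alpha>\<in>{0<..1}. \<forall>\<zeta>\<in>{0<..\<alpha>}.
              (\<lambda>n. Hstar dist (alpha_cut (U n) \<alpha>) (alpha_cut u (\<alpha> - \<zeta>))) \<longlonglongrightarrow> 0)
        \<longleftrightarrow> (\<exists>P. dense_subset P {0<..1} \<and> (\<forall>\<alpha>\<in>P. \<forall>\<zeta>\<in>{0<..\<alpha>}.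
              (\<lambda>n. Hstar dist (alpha_cut (U n) \<alpha>) (alpha_cut u (\<alpha> - \<zeta>))) \<longlonglongrightarrow> 0)))"
proof -
  have u: "\<forall>\<^sub>F n in sequentially. \<forall>x. 0 \<le> u x"
    using assms(1) by (simp add: F1_USC_def fuzzy_set_def)
  have U: "\<forall>\<^sub>F n in sequentially. \<forall>x. 0 \<le> U n x"
    using assms(2) by (auto simp: F1_USC_def fuzzy_set_def intro: eventually_sequentiallyI[of 1])

  let ?up = "\<lambda>s t. (\<lambda>n. Hstar dist (alpha_cut u t) (alpha_cut (U n) s)) \<longlonglongrightarrow> 0"
  let ?up2 = "\<lambda>P. \<forall>\<alpha>\<in>P. \<forall>\<xi>\<in>{0<..1 - \<alpha>}. ?up \<alpha> (\<alpha> + \<xi>)"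
  have up_dense: "\<forall>s t. 0 \<le> s \<longrightarrow> s < t \<longrightarrow> t \<le> 1 \<longrightarrow> ?up s t"
    if "dense_subset P {0..<1}" "?up2 P" for P
    using tendsto_Hstar_alpha_cut_dense_lower[OF that] by blast
  have up_all: "?up2 {0..<1}" if "\<forall>s t. 0 \<le> s \<longrightarrow> s < t \<longrightarrow> t \<le> 1 \<longrightarrow> ?up s t"
    using that by simp

  let ?lo = "\<lambda>s t. (\<lambda>n. Hstar dist (alpha_cut (U n) t) (alpha_cut u s)) \<longlonglongrightarrow> 0"
  let ?lo2 = "\<lambda>P. \<forall>\<alpha>\<in>P. \<forall>\<zeta>\<in>{0<..\<alpha>}. ?lo (\<alpha> - \<zeta>) \<alpha>"
  have lo_dense: "\<forall>s t. 0 \<le> s \<longrightarrow> s < t \<longrightarrow> t \<le> 1 \<longrightarrow> ?lo s t"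
    if "dense_subset P {0<..1}" "?lo2 P" for P
    using tendsto_Hstar_alpha_cut_dense_upper[OF that] by blast
  have lo_all: "?lo2 {0<..1}" if "\<forall>s t. 0 \<le> s \<longrightarrow> s < t \<longrightarrow> t \<le> 1 \<longrightarrow> ?lo s t"
    using that by simp

  show ?thesis
    unfolding tendsto_Hstar_endograph_iff[OF U, of "\<lambda>_. u"]
      tendsto_Hstar_endograph_iff[OF u, of U]
  proof (intro conjI)
    show "(\<forall>s t. 0 \<le> s \<longrightarrow> s < t \<longrightarrow> t \<le> 1 \<longrightarrow> ?up s t) \<longleftrightarrow> ?up2 {0..<1}"
      using up_all up_dense[OF dense_subset_refl] by argo
    show "?up2 {0..<1} \<longleftrightarrow> (\<exists>P. dense_subset P {0..<1} \<and> ?up2 P)"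
      using dense_subset_refl up_dense[THEN up_all] by blast
    show "(\<forall>s t. 0 \<le> s \<longrightarrow> s < t \<longrightarrow> t \<le> 1 \<longrightarrow> ?lo s t) \<longleftrightarrow> ?lo2 {0<..1}"
      using lo_all lo_dense[OF dense_subset_refl] by argo
    show "?lo2 {0<..1} \<longleftrightarrow> (\<exists>P. dense_subset P {0<..1} \<and> ?lo2 P)"
      using dense_subset_refl lo_dense[THEN lo_all] by blast
  qed
qed

end
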